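(* The generating function $$\mathrm{HSP}(x,y,q,h)=\sum_{n,k\geq 0}\ \sum_{\pi\in C_{n,k}}x^n y^k q^{\mathrm{sp}(\pi)}h^{\mathrm{hsp}(\pi)}$$ for the number of compositions of $n$ with exactly $k$ parts according to the number of symmetric peaks and the sum of the heights of symmetric peaks is given by $$\mathrm{HSP}(x,y,q,h)=\frac{1}{1-\sum_{a\geq1}\dfrac{x^ay}{1-y^2x^{2a+1}\left(\dfrac{qh}{1-hx}-\dfrac{1}{1-x}\right)}}.$$
   Context: A composition of a positive integer $n$ with $k$ parts is a sequence $\pi=\pi_1\pi_2\cdots\pi_k$ of positive integers with $\sum_{i=1}^k\pi_i=n$. $C_{n,k}$ denotes the set of all compositions of $n$ with exactly $k$ parts, with the conventions $|C_{0,0}|=1$ (the empty composition), $|C_{0,k}|=0$ for $k\ge 1$. A symmetric peak of $\pi$ is a triple of consecutive parts $\pi_i\pi_{i+1}\pi_{i+2}$ ($1\le i\le k-2$) with $\pi_i<\pi_{i+1}$ and $\pi_i=\pi_{i+2}$; its height is $\pi_{i+1}-\pi_i$. $\mathrm{sp}(\pi)$ is the number of symmetric peaks of $\pi$ (number of such indices $i$), and $\mathrm{hsp}(\pi)$ is the sum of the heights of all symmetric peaks of $\pi$. The identity is one of formal power series in $x$ with coefficients polynomial in $y,q,h$. *)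

theory Defs
  imports "HOL-Computational_Algebra.Computational_Algebra"
begin

definition compositions :: "nat \<Rightarrow> nat \<Rightarrow> nat list set" where
  "compositions n k = {\<pi>. length \<pi> = k \<and> (\<forall>a\<in>set \<pi>. 1 \<le> a) \<and> sum_list \<pi> = n}"

text \<open>Positions are 0-based: \<open>i\<close> is the index of the first of the three consecutive parts.\<close>

definition symmetric_peaks :: "nat list \<Rightarrow> nat set" where
  "symmetric_peaks \<pi> = {i. i + 2 < length \<pi> \<and> \<pi> ! i < \<pi> ! (i + 1) \<and> \<pi> ! i = \<pi> ! (i + 2)}"

definition sp :: "nat list \<Rightarrow> nat" where
  "sp \<pi> = card (symmetric_peaks \<pi>)"

definition hsp :: "nat list \<Rightarrow> nat" where
  "hsp \<pi> = (\<Sum>i\<in>symmetric_peaks \<pi>. \<pi> ! (i + 1) - \<pi> ! i)"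

text \<open>
  Polynomials in the three indeterminates \<open>y, q, h\<close> with integer coefficients,
  as iterated univariate polynomials: \<open>y\<close> is the outermost indeterminate, \<open>h\<close> the innermost.
\<close>

type_synonym poly_yqh = "int poly poly poly"

definition var_y :: poly_yqh where "var_y = [:0, 1:]"
definition var_q :: poly_yqh where "var_q = [:[:0, 1:]:]"
definition var_h :: poly_yqh where "var_h = [:[:[:0, 1:]:]:]"

text \<open>
  The coefficient of \<open>x^n\<close> is a sum over all \<open>k\<close>; it is finite and may be cut off
  at \<open>k = n\<close>, since a composition of \<open>n\<close> has at most \<open>n\<close> parts.
\<close>

definition HSP :: "poly_yqh fps" where
  "HSP = Abs_fps (\<lambda>n. \<Sum>k\<le>n. \<Sum>\<pi>\<in>compositions n k.
            var_y ^ k * var_q ^ sp \<pi> * var_h ^ hsp \<pi>)"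

lemma compositions_empty:
  assumes "n < k"
  shows "compositions n k = {}"
proof -
  have "length \<pi> \<le> sum_list \<pi>" if "\<forall>a\<in>set \<pi>. 1 \<le> a" for \<pi> :: "nat list"
    using that by (induction \<pi>) auto
  with assms show ?thesis
    by (fastforce simp: compositions_def)
qed

lemma finite_compositions: "finite (compositions n k)"
proof (rule finite_subset)
  show "compositions n k \<subseteq> {\<pi>. set \<pi> \<subseteq> {..n} \<and> length \<pi> = k}"
    by (auto simp: compositions_def member_le_sum_list)
  show "finite {\<pi>. set \<pi> \<subseteq> {..n} \<and> length \<pi> = k}"
    by (rule finite_lists_length_eq) simp
qed

text \<open>
  Division of power series is available over fields only, so identities with quotients are
  stated after the (injective) coefficientwise embedding into power series over the fraction
  field of the polynomial ring. All denominators below have constant term \<open>1\<close>.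
\<close>

definition embed :: "poly_yqh fps \<Rightarrow> poly_yqh fract fps" where
  "embed F = Abs_fps (\<lambda>n. to_fract (fps_nth F n))"

lemma inj_embed: "inj embed"
  by (rule injI) (simp add: embed_def fps_eq_iff)

abbreviation X :: "poly_yqh fract fps" where "X \<equiv> fps_X"
abbreviation Y :: "poly_yqh fract fps" where "Y \<equiv> fps_const (to_fract var_y)"
abbreviation Q :: "poly_yqh fract fps" where "Q \<equiv> fps_const (to_fract var_q)"
abbreviation H :: "poly_yqh fract fps" where "H \<equiv> fps_const (to_fract var_h)"

definition HSP_summand :: "nat \<Rightarrow> poly_yqh fract fps" where
  "HSP_summand a =
     X ^ a * Y / (1 - Y\<^sup>2 * X ^ (2 * a + 1) * (Q * H / (1 - H * X) - 1 / (1 - X)))"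

text \<open>The series converges in the metric topology of formal power series.\<close>

lemma summable_HSP_summand: "summable (\<lambda>a. HSP_summand (Suc a))"
proof -
  have nth0: "fps_nth (HSP_summand a) n = 0" if "n < a" for a n
  proof -
    define D where "D = 1 - Y\<^sup>2 * X ^ (2 * a + 1) * (Q * H / (1 - H * X) - 1 / (1 - X))"
    have "fps_nth D 0 \<noteq> 0"
      by (simp add: D_def)
    hence "HSP_summand a = X ^ a * (Y * inverse D)"
      by (simp add: HSP_summand_def D_def fps_divide_unit mult.assoc)
    thus ?thesis
      using that by (simp add: fps_X_power_mult_nth)
  qed
  have "(\<lambda>a. HSP_summand (Suc a)) sums
          Abs_fps (\<lambda>n. \<Sum>a<n. fps_nth (HSP_summand (Suc a)) n)"
    unfolding sums_def
  proof (rule tendsto_fpsI)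
    fix n
    show "\<forall>\<^sub>F N in sequentially. fps_nth (\<Sum>a<N. HSP_summand (Suc a)) n =
            fps_nth (Abs_fps (\<lambda>n. \<Sum>a<n. fps_nth (HSP_summand (Suc a)) n)) n"
      using eventually_ge_at_top[of n]
    proof eventually_elim
      case (elim N)
      have "(\<Sum>a<N. fps_nth (HSP_summand (Suc a)) n) = (\<Sum>a<n. fps_nth (HSP_summand (Suc a)) n)"
        by (rule sum.mono_neutral_right) (use elim nth0 in auto)
      thus ?case
        by (simp add: fps_sum_nth)
    qed
  qed
  thus ?thesis
    by (rule sums_summable)
qed

end

theory Submission
  imports Defs
begin

text \<open>
  The idea is to classify compositions by their first part. Write \<open>F\<close> for the generating function
  of all compositions and \<open>F\<^sub>a\<close> for that of the compositions beginning with \<open>a\<close>, so that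
  \<open>F = 1 + (\<Sum>a\<ge>1. F\<^sub>a)\<close> (\<open>comp_gf_by_first_part\<close>).

  Prepending \<open>a\<close> to an arbitrary composition multiplies its weight by \<open>x\<^sup>a y\<close>, except when the
  result begins with a symmetric peak \<open>a, a + d, a\<close>, \<open>d > 0\<close>; then there is an additional factor
  \<open>q h\<^sup>d\<close>. In the exceptional case the composition is \<open>a, a + d, \<rho>\<close> with \<open>\<rho>\<close> again beginning
  with \<open>a\<close>, and since \<open>a + d > a\<close> no peak starts at the second part. Every composition \<open>\<rho>\<close>
  beginning with \<open>a\<close> and every \<open>d > 0\<close> arise in exactly one way. Hence the weights that were
  counted without the factor \<open>q h\<^sup>d\<close> are corrected by
  \<open>F\<^sub>a = x\<^sup>a y F + (\<Sum>d>0. x\<^sup>a y x\<^bsup>a+d\<^esup> y (q h\<^sup>d - 1)) F\<^sub>a\<close>,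
  which is \<open>comp_gf_starting_with\<close>. This is a linear equation for \<open>F\<^sub>a\<close>. The sum over \<open>d\<close> is a
  difference of two geometric series (\<open>peak_correction_conv\<close>), and solving the equation gives
  \<open>F\<^sub>a = S\<^sub>a F\<close>, where \<open>S\<^sub>a\<close> is the summand in the denominator of the claim
  (\<open>comp_gf_starting_with_conv_HSP_summand\<close>). Therefore \<open>F = 1 + (\<Sum>a\<ge>1. S\<^sub>a) F\<close>,
  and it remains to solve for \<open>F\<close>.
\<close>

section \<open>The weight of a composition\<close>

definition weight :: "'a::comm_ring_1 \<Rightarrow> 'a \<Rightarrow> 'a \<Rightarrow> nat list \<Rightarrow> 'a" where
  "weight y q h \<pi> = y ^ length \<pi> * q ^ sp \<pi> * h ^ hsp \<pi>"

definition peak_prefix :: "nat list \<Rightarrow> bool" where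
  "peak_prefix \<pi> \<longleftrightarrow> (\<exists>a d \<tau>. 0 < d \<and> \<pi> = a # (a + d) # a # \<tau>)"

lemma symmetric_peaks_Cons:
  "symmetric_peaks (a # \<sigma>) = (if peak_prefix (a # \<sigma>) then {0} else {}) \<union> Suc ` symmetric_peaks \<sigma>"
proof (rule set_eqI)
  fix i
  have "peak_prefix (a # \<sigma>) \<longleftrightarrow> Suc 0 < length \<sigma> \<and> a < \<sigma> ! 0 \<and> a = \<sigma> ! 1"
  proof
    assume "Suc 0 < length \<sigma> \<and> a < \<sigma> ! 0 \<and> a = \<sigma> ! 1"
    moreover from this obtain b c \<tau> where "\<sigma> = b # c # \<tau>"
      by (cases \<sigma>; cases "tl \<sigma>") auto
    ultimately show "peak_prefix (a # \<sigma>)"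
      unfolding peak_prefix_def by (intro exI[of _ a] exI[of _ "b - a"] exI[of _ \<tau>]) auto
  qed (auto simp: peak_prefix_def)
  thus "i \<in> symmetric_peaks (a # \<sigma>) \<longleftrightarrow>
      i \<in> (if peak_prefix (a # \<sigma>) then {0} else {}) \<union> Suc ` symmetric_peaks \<sigma>"
    by (cases i) (auto simp: symmetric_peaks_def)
qed

lemma finite_symmetric_peaks [simp]: "finite (symmetric_peaks \<pi>)"
  by (rule finite_subset[of _ "{..length \<pi>}"]) (auto simp: symmetric_peaks_def)

lemma weight_Nil [simp]: "weight y q h [] = 1"
  by (simp add: weight_def sp_def hsp_def symmetric_peaks_def)

lemma weight_Cons_no_peak:
  assumes "\<not> peak_prefix (a # \<sigma>)"
  shows "weight y q h (a # \<sigma>) = y * weight y q h \<sigma>"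
  using assms
  by (simp add: weight_def sp_def hsp_def symmetric_peaks_Cons card_image sum.reindex)

lemma weight_Cons_peak:
  assumes "0 < d"
  shows "weight y q h (a # (a + d) # a # \<tau>) = y * (q * h ^ d) * weight y q h ((a + d) # a # \<tau>)"
proof -
  have "peak_prefix (a # (a + d) # a # \<tau>)"
    using assms by (auto simp: peak_prefix_def)
  thus ?thesis
    by (simp add: weight_def sp_def hsp_def symmetric_peaks_Cons[of a] card_insert_if
        card_image sum.reindex power_add mult_ac)
qed

text \<open>
  This is what keeps the recurrence for a fixed first part closed: the first part of a symmetric
  peak is smaller than the second, so no peak starts at the top of another one.
\<close>

lemma weight_Cons_higher:
  assumes "0 < d"
  shows "weight y q h ((a + d) # a # \<tau>) = y * weight y q h (a # \<tau>)"
  by (rule weight_Cons_no_peak) (use assms in \<open>auto simp: peak_prefix_def\<close>)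

section \<open>Generating functions of sets of compositions\<close>

definition all_compositions :: "nat \<Rightarrow> nat list set" where
  "all_compositions n = {\<pi>. (\<forall>a\<in>set \<pi>. 1 \<le> a) \<and> sum_list \<pi> = n}"

lemma all_compositions_conv_Union: "all_compositions n = (\<Union>k\<le>n. compositions n k)"
proof -
  have "k \<le> n" if "\<pi> \<in> compositions n k" for \<pi> k
    using compositions_empty[of n k] that by (cases "n < k") auto
  thus ?thesis
    by (auto simp: all_compositions_def compositions_def)
qed

lemma finite_all_compositions [simp]: "finite (all_compositions n)"
  by (simp add: all_compositions_conv_Union finite_compositions)

lemma sum_all_compositions:
  "(\<Sum>\<pi>\<in>all_compositions n. f \<pi>) = (\<Sum>k\<le>n. \<Sum>\<pi>\<in>compositions n k. f \<pi>)"
  unfolding all_compositions_conv_Union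
  by (rule sum.UNION_disjoint) (simp_all add: finite_compositions, auto simp: compositions_def)

lemma Cons_in_all_compositions:
  "a # \<sigma> \<in> all_compositions n \<longleftrightarrow> 1 \<le> a \<and> a \<le> n \<and> \<sigma> \<in> all_compositions (n - a)"
  unfolding all_compositions_def by auto

definition comp_gf :: "'a::comm_ring_1 \<Rightarrow> 'a \<Rightarrow> 'a \<Rightarrow> nat list set \<Rightarrow> 'a fps" where
  "comp_gf y q h S = Abs_fps (\<lambda>n. \<Sum>\<pi>\<in>all_compositions n \<inter> S. weight y q h \<pi>)"

abbreviation starting_with :: "nat \<Rightarrow> nat list set" where
  "starting_with a \<equiv> range ((#) a)"

text \<open>
  A composition of \<open>n\<close> has no part larger than \<open>n\<close>. So for each single coefficient a finite sum
  over the first part is enough, and limits of generating functions can wait until the very end.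
\<close>

lemma comp_gf_by_first_part:
  assumes "n \<le> N"
  shows "fps_nth (comp_gf y q h UNIV) n =
    fps_nth (1 + (\<Sum>a<N. comp_gf y q h (starting_with (Suc a)))) n"
proof -
  have split: "all_compositions n =
      (all_compositions n \<inter> {[]}) \<union> (\<Union>a<N. all_compositions n \<inter> starting_with (Suc a))"
  proof -
    have "\<pi> = [] \<or> (\<exists>a<N. \<pi> \<in> starting_with (Suc a))" if "\<pi> \<in> all_compositions n" for \<pi>
    proof (cases \<pi>)
      case (Cons b \<sigma>)
      with that have "1 \<le> b" "b \<le> N"
        using assms by (auto simp: Cons_in_all_compositions)
      thus ?thesis
        using Cons by (intro disjI2 exI[of _ "b - 1"]) auto
    qed simp
    thus ?thesis by blast
  qed
  have "sum (weight y q h) (all_compositions n) =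
      sum (weight y q h) (all_compositions n \<inter> {[]}) +
      sum (weight y q h) (\<Union>a<N. all_compositions n \<inter> starting_with (Suc a))"
    by (subst split, rule sum.union_disjoint) auto
  also have "sum (weight y q h) (\<Union>a<N. all_compositions n \<inter> starting_with (Suc a)) =
      (\<Sum>a<N. sum (weight y q h) (all_compositions n \<inter> starting_with (Suc a)))"
    by (rule sum.UNION_disjoint) auto
  also have "all_compositions n \<inter> {[]} = (if n = 0 then {[]} else {})"
    by (auto simp: all_compositions_def)
  finally show ?thesis
    by (simp add: comp_gf_def fps_sum_nth)
qed

section \<open>The recurrence for a prescribed first part\<close>

text \<open>
  The exponent \<open>d\<close> of the series variable is the height of a peak at the beginning of a
  composition. The \<open>-1\<close> removes the weight that this composition would get if the peak were ignored.
  A symmetric peak has positive height, so the constant term is \<open>0\<close>.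
\<close>

definition peak_correction :: "'a::comm_ring_1 \<Rightarrow> 'a \<Rightarrow> 'a fps" where
  "peak_correction q h = Abs_fps (\<lambda>d. if d = 0 then 0 else q * h ^ d - 1)"

text \<open>
  The error made by ignoring the peak at the beginning. A composition \<open>\<sigma>\<close> such that \<open>a # \<sigma>\<close> begins
  with a symmetric peak of height \<open>d\<close> is \<open>(a + d) # \<rho>\<close> with \<open>\<rho>\<close> beginning with \<open>a\<close>; the pairs
  \<open>(d, \<rho>)\<close> are unrestricted apart from \<open>d > 0\<close>, and the sizes of \<open>d\<close> and \<open>\<rho>\<close> add up to \<open>m - a\<close>.
  So the sum over \<open>\<sigma>\<close> is a coefficient of a Cauchy product. One factor \<open>y\<close> belongs to the first
  part \<open>a\<close> and the other one to the top \<open>a + d\<close>.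
\<close>

lemma sum_peak_prefix:
  fixes y q h :: "'a::comm_ring_1"
  assumes "1 \<le> a"
  shows "(\<Sum>\<sigma>\<in>{\<sigma> \<in> all_compositions m. peak_prefix (a # \<sigma>)}.
            weight y q h (a # \<sigma>) - y * weight y q h \<sigma>) =
         fps_nth (fps_X ^ a * (fps_const (y\<^sup>2) * (peak_correction q h *
            comp_gf y q h (starting_with a)))) m"
    (is "?lhs = _")
proof -
  let ?S = "starting_with a"
  let ?T = "\<lambda>d. all_compositions (m - a - d) \<inter> ?S"
  have "?lhs = (\<Sum>(d, \<rho>)\<in>Sigma {1..m - a} ?T. y\<^sup>2 * ((q * h ^ d - 1) * weight y q h \<rho>))"
  proof (rule sum.reindex_bij_witness[where j = "\<lambda>\<sigma>. (hd \<sigma> - a, tl \<sigma>)"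
        and i = "\<lambda>(d, \<rho>). (a + d) # \<rho>"], goal_cases)
    case (1 \<sigma>)
    thus ?case by (auto simp: peak_prefix_def)
  next
    case (2 \<sigma>)
    thus ?case using assms by (auto simp: peak_prefix_def Cons_in_all_compositions)
  next
    case (3 z)
    thus ?case by auto
  next
    case (4 z)
    thus ?case using assms by (auto simp: peak_prefix_def Cons_in_all_compositions)
  next
    case (5 \<sigma>)
    then obtain d \<tau> where "0 < d" "\<sigma> = (a + d) # a # \<tau>"
      by (auto simp: peak_prefix_def)
    thus ?case
      by (simp add: weight_Cons_peak weight_Cons_higher power2_eq_square algebra_simps)
  qed
  also have "\<dots> = (\<Sum>d=1..m - a. \<Sum>\<rho>\<in>?T d. y\<^sup>2 * ((q * h ^ d - 1) * weight y q h \<rho>))"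
    by (rule sum.Sigma[symmetric]) auto
  also have "\<dots> = y\<^sup>2 * (\<Sum>d=1..m - a. fps_nth (peak_correction q h) d *
      fps_nth (comp_gf y q h ?S) (m - a - d))"
    by (simp add: peak_correction_def comp_gf_def sum_distrib_left)
  also have "(\<Sum>d=1..m - a. fps_nth (peak_correction q h) d *
      fps_nth (comp_gf y q h ?S) (m - a - d)) =
      fps_nth (peak_correction q h * comp_gf y q h ?S) (m - a)"
    unfolding fps_mult_nth
    by (rule sum.mono_neutral_left) (auto simp: peak_correction_def not_le Suc_le_eq)
  also have "y\<^sup>2 * fps_nth (peak_correction q h * comp_gf y q h ?S) (m - a) =
      fps_nth (fps_X ^ a * (fps_const (y\<^sup>2) * (peak_correction q h * comp_gf y q h ?S))) m"
    \<comment> \<open>If \<open>m < a\<close>, then \<open>m - a = 0\<close>, where the correction vanishes because its constant term does.\<close>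
    by (cases "m < a") (simp_all add: fps_X_power_mult_nth peak_correction_def)
  finally show ?thesis .
qed

text \<open>
  The first summand counts the compositions \<open>a # \<sigma>\<close> as if no peak ever started at \<open>a\<close>; the second
  one repairs this for those \<open>\<sigma>\<close> where a peak does start there.
\<close>

lemma comp_gf_starting_with:
  fixes y q h :: "'a::comm_ring_1"
  assumes "1 \<le> a"
  shows "comp_gf y q h (starting_with a) =
    fps_X ^ a * (fps_const y * comp_gf y q h UNIV +
      fps_X ^ a * (fps_const (y\<^sup>2) * (peak_correction q h * comp_gf y q h (starting_with a))))"
proof (rule fps_ext)
  fix n
  show "fps_nth (comp_gf y q h (starting_with a)) n = fps_nth (fps_X ^ a *
      (fps_const y * comp_gf y q h UNIV + fps_X ^ a * (fps_const (y\<^sup>2) *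
        (peak_correction q h * comp_gf y q h (starting_with a))))) n"
  proof (cases "n < a")
    case True
    hence "all_compositions n \<inter> starting_with a = {}"
      by (auto simp: Cons_in_all_compositions)
    with True show ?thesis
      by (simp add: comp_gf_def fps_X_power_mult_nth)
  next
    case False
    define m where "m = n - a"
    have "all_compositions n \<inter> starting_with a = (#) a ` all_compositions m"
      using False assms by (auto simp: Cons_in_all_compositions m_def)
    hence "fps_nth (comp_gf y q h (starting_with a)) n =
        (\<Sum>\<sigma>\<in>all_compositions m. weight y q h (a # \<sigma>))"
      by (simp add: comp_gf_def sum.reindex)
    also have "\<dots> = (\<Sum>\<sigma>\<in>all_compositions m. y * weight y q h \<sigma>) +
        (\<Sum>\<sigma>\<in>all_compositions m. weight y q h (a # \<sigma>) - y * weight y q h \<sigma>)"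
      by (simp flip: sum.distrib)
    also have "(\<Sum>\<sigma>\<in>all_compositions m. weight y q h (a # \<sigma>) - y * weight y q h \<sigma>) =
        (\<Sum>\<sigma>\<in>{\<sigma> \<in> all_compositions m. peak_prefix (a # \<sigma>)}.
          weight y q h (a # \<sigma>) - y * weight y q h \<sigma>)"
      by (rule sum.mono_neutral_right) (auto simp: weight_Cons_no_peak)
    also note sum_peak_prefix[OF assms]
    also have "(\<Sum>\<sigma>\<in>all_compositions m. y * weight y q h \<sigma>) =
        fps_nth (fps_const y * comp_gf y q h UNIV) m"
      by (simp add: comp_gf_def sum_distrib_left)
    finally show ?thesis
      using False by (simp add: fps_X_power_mult_nth[of a] m_def)
  qed
qed

section \<open>Passing to quotients of power series\<close>

lemma geometric_fps:
  fixes c :: "'a::field"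
  shows "1 / (1 - fps_const c * fps_X) = Abs_fps (\<lambda>n. c ^ n)"
proof -
  define G where "G = Abs_fps (\<lambda>n. c ^ n)"
  have "G = 1 + fps_const c * (fps_X * G)"
  proof (rule fps_ext)
    fix n
    show "fps_nth G n = fps_nth (1 + fps_const c * (fps_X * G)) n"
      by (cases n) (simp_all add: G_def)
  qed
  hence "G * (1 - fps_const c * fps_X) = 1"
    by (simp add: algebra_simps)
  moreover from this have "1 - fps_const c * fps_X \<noteq> 0"
    by (metis mult_zero_right zero_neq_one)
  ultimately show ?thesis
    by (metis G_def nonzero_mult_div_cancel_right)
qed

lemma peak_correction_conv:
  fixes q h :: "'a::field"
  shows "peak_correction q h = fps_X *
    (fps_const q * fps_const h / (1 - fps_const h * fps_X) - 1 / (1 - fps_X))"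
proof -
  have "fps_const q * fps_const h / (1 - fps_const h * fps_X) =
      fps_const (q * h) * Abs_fps (\<lambda>n. h ^ n)"
    by (simp add: geometric_fps[symmetric] fps_divide_unit)
  moreover have "1 / (1 - fps_X) = Abs_fps (\<lambda>n. 1 :: 'a)"
    using geometric_fps[of 1] by simp
  ultimately show ?thesis
    by (intro fps_ext) (simp add: peak_correction_def power_eq_if)
qed

lemma comp_gf_starting_with_conv_HSP_summand:
  assumes "1 \<le> a"
  defines "y \<equiv> to_fract var_y" and "q \<equiv> to_fract var_q" and "h \<equiv> to_fract var_h"
  shows "comp_gf y q h (starting_with a) = HSP_summand a * comp_gf y q h UNIV"
proof -
  define F G where "F = comp_gf y q h UNIV" and "G = comp_gf y q h (starting_with a)"
  define D where "D = 1 - Y\<^sup>2 * X ^ (2 * a + 1) * (Q * H / (1 - H * X) - 1 / (1 - X))"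
  have X_power: "X ^ (2 * a + 1) = X ^ a * (X ^ a * X)"
    by (simp add: mult_2 power_add)
  have D_conv: "D = 1 - Y\<^sup>2 * (X ^ a * (X ^ a * peak_correction q h))"
    unfolding D_def peak_correction_conv q_def h_def X_power by (simp only: mult.assoc)
  have Y_square: "fps_const (y\<^sup>2) = Y\<^sup>2"
    by (simp add: y_def)
  have "G = X ^ a * (Y * F + X ^ a * (Y\<^sup>2 * (peak_correction q h * G)))"
    using comp_gf_starting_with[OF assms(1), of y q h]
    unfolding F_def[symmetric] G_def[symmetric] Y_square unfolding y_def .
  also have "\<dots> = X ^ a * Y * F + Y\<^sup>2 * (X ^ a * (X ^ a * peak_correction q h)) * G"
    by (simp only: distrib_left mult_ac)
  finally have "G - Y\<^sup>2 * (X ^ a * (X ^ a * peak_correction q h)) * G = X ^ a * Y * F"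
    by (simp only: diff_eq_eq)
  hence DG: "D * G = X ^ a * Y * F"
    unfolding D_conv by (simp only: left_diff_distrib mult_1)
  have D0: "fps_nth D 0 \<noteq> 0"
    by (simp add: D_def)
  have "HSP_summand a = X ^ a * Y / D"
    by (simp only: HSP_summand_def D_def)
  hence "HSP_summand a = inverse D * (X ^ a * Y)"
    by (simp only: fps_divide_unit[OF D0] mult.commute)
  hence "HSP_summand a * F = inverse D * (X ^ a * Y * F)"
    by (simp only: mult.assoc)
  also have "\<dots> = inverse D * D * G"
    by (simp only: DG mult.assoc[of "inverse D" D G])
  also have "\<dots> = G"
    by (simp only: inverse_mult_eq_1[OF D0] mult_1)
  finally have "HSP_summand a * F = G" .
  thus ?thesis
    by (simp only: F_def G_def)
qed

text \<open>
  The generating functions above make sense over any commutative ring, so they can be formed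
  directly over the fraction field, where the embedded indeterminates are just scalars.
\<close>

lemma embed_HSP:
  "embed HSP = comp_gf (to_fract var_y) (to_fract var_q) (to_fract var_h) UNIV"
proof -
  have "to_fract (p ^ k) = to_fract p ^ k" for p :: poly_yqh and k
    by (induction k) simp_all
  thus ?thesis
    by (auto simp: fps_eq_iff embed_def HSP_def comp_gf_def weight_def sum_all_compositions
        compositions_def intro!: sum.cong)
qed

theorem theorem1:
  shows "embed HSP = 1 / (1 - (\<Sum>a. HSP_summand (Suc a)))"
proof -
  define F S where "F = embed HSP" and "S = (\<Sum>a. HSP_summand (Suc a))"
  have partial_sums: "(\<lambda>N. \<Sum>a<N. HSP_summand (Suc a)) \<longlonglongrightarrow> S"
    unfolding S_def by (rule summable_LIMSEQ[OF summable_HSP_summand])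
  have "F = 1 + S * F"
  proof (rule fps_ext)
    fix n
    \<comment> \<open>The coefficient of index \<open>n\<close> of a product sees only finitely many coefficients of the
      infinite sum, and these agree with those of a sufficiently long partial sum.\<close>
    have "\<forall>\<^sub>F N in sequentially. \<forall>i\<in>{..n}. fps_nth (\<Sum>a<N. HSP_summand (Suc a)) i = fps_nth S i"
      using partial_sums by (intro eventually_ball_finite) (auto simp: tendsto_fps_iff)
    moreover have "\<forall>\<^sub>F N in sequentially. n \<le> N"
      by (rule eventually_ge_at_top)
    ultimately have "\<forall>\<^sub>F N in sequentially.
        (\<forall>i\<in>{..n}. fps_nth (\<Sum>a<N. HSP_summand (Suc a)) i = fps_nth S i) \<and> n \<le> N"
      by (rule eventually_conj)
    then obtain N where "n \<le> N"
      and "\<forall>i\<in>{..n}. fps_nth (\<Sum>a<N. HSP_summand (Suc a)) i = fps_nth S i"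
      using eventually_happens'[OF sequentially_bot] by blast
    hence N: "fps_nth (\<Sum>a<N. HSP_summand (Suc a)) i = fps_nth S i" if "i \<le> n" for i
      using that by simp
    have "fps_nth F n = fps_nth (1 + (\<Sum>a<N. HSP_summand (Suc a) * F)) n"
      using comp_gf_by_first_part[OF \<open>n \<le> N\<close>,
          where y = "to_fract var_y" and q = "to_fract var_q" and h = "to_fract var_h"]
      by (simp add: F_def embed_HSP comp_gf_starting_with_conv_HSP_summand)
    also have "\<dots> = fps_nth 1 n + fps_nth ((\<Sum>a<N. HSP_summand (Suc a)) * F) n"
      by (simp only: sum_distrib_right fps_add_nth)
    also have "fps_nth ((\<Sum>a<N. HSP_summand (Suc a)) * F) n = fps_nth (S * F) n"
      unfolding fps_mult_nth by (rule sum.cong) (use N in auto)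
    finally show "fps_nth F n = fps_nth (1 + S * F) n"
      by (simp only: fps_add_nth)
  qed
  hence "F - S * F = 1"
    by (simp only: diff_eq_eq)
  hence "F * (1 - S) = 1"
    by (simp only: right_diff_distrib mult_1_right mult.commute)
  moreover from this have "1 - S \<noteq> 0"
    by auto
  ultimately have "F = 1 / (1 - S)"
    by (metis nonzero_mult_div_cancel_right)
  thus ?thesis
    by (simp add: F_def S_def)
qed

end
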